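(* Let $k$ be a fixed positive integer and let $D$ be a degree sequence. Then any application of the algorithm MAX (with parameter $k$) to any loopless multigraph with degree sequence $D$ results in a $k$-independent set of cardinality at least $b_k(D)$. Furthermore, there exists a loopless multigraph $G$ with degree sequence $D$ such that some application of MAX to $G$ results in a $k$-independent set of cardinality exactly $b_k(D)$.
   Context: All multigraphs are finite and loopless (parallel edges are allowed). The degree of a vertex is the number of edges incident with it, and $\Delta(G)$ is the maximum degree of $G$. $G-v$ is obtained from $G$ by deleting the vertex $v$ and all edges incident with it. The degree sequence of a multigraph $G$ is the multiset $\{\deg_G(v): v\in V(G)\}$; a multiset is called a degree sequence if it is the degree sequence of some loopless multigraph; its order is its number of elements (with multiplicity). For a finite multiset $D$ of integers, $\sum D$ is the sum of its elements with multiplicity and $\max(D)$ its maximum element. A subset $S$ of the vertex set of a multigraph $G$ is $k$-independent if the subgraph of $G$ induced by $S$ has maximum degree less than $k$. Algorithm MAX, on input a multigraph $G$: set $H:=G$; while $\Delta(H)\geq k$, choose an arbitrary vertex $v$ of $H$ with $\deg_H(v)=\Delta(H)$ and replace $H$ by $H-v$; finally return $V(H)$. "Any application of MAX" means for any choices of the maximum degree vertices throughout the algorithm, and "some application of MAX" means for some choices. A degree sequence is trivial if its maximum element is less than $k$ (the empty multiset counts as trivial), and nontrivial otherwise. For multisets $X,Y$ of nonnegative integers, $X\uplus Y$ is the multiset in which multiplicities are added, and $X\setminus Y$ is the multiset in which the multiplicity of $z$ is $\max(0,\mu_X(z)-\mu_Y(z))$, where $\mu_X(z)$ is the multiplicity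 of $z$ in $X$. If $x$ is a positive element of a multiset $X$ of nonnegative integers, then the multiset obtained from $X$ by an $x$-decrement is $(X\setminus\{x\})\uplus\{x-1\}$. Definition of $\Omega(D)$ (depending on $k$). Let $D$ be a degree sequence of order $n\geq 1$ and let $A_0=D\setminus\{\max(D)\}$. If $\sum A_0<\max(D)+2k$ or $\max(A_0)<k$, then $\Omega(D)$ is the multiset $\{0,\ldots,0\}$ with $n-1$ elements. Otherwise let $s=\sum A_0$ and let $A_1,\ldots,A_s$ be the sequence of multisets such that, for $i=1,\ldots,s$, $A_i$ is obtained from $A_{i-1}$ by an $a_i$-decrement, where $a_i=\max(A_{i-1})$ if $\max(A_{i-1})>k$, and $a_i$ is the smallest positive element of $A_{i-1}$ otherwise. Then $\Omega(D)=A_{\max(D)}$. ($\Omega(D)$ is always a degree sequence of order $n-1$.) Let $\Omega^0(D)=D$ and $\Omega^{i+1}(D)=\Omega(\Omega^i(D))$ for $0\leq i<n$. Definition of $b_k(D)$. For a degree sequence $D$ of order $n$, $b_k(D)=|\Omega^p(D)|=n-p$, where $p$ is the least nonnegative integer such that $\Omega^p(D)$ is trivial (such a $p\leq n$ exists since $\Omega^n(D)$ is empty). *)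

theory Defs
  imports "HOL-Library.Multiset"
begin

text \<open>An edge is represented by the set of its two ends; parallel edges are repeated elements
  of the multiset of edges.\<close>

record 'a multigraph =
  verts :: "'a set"
  edges :: "'a set multiset"

definition loopless_multigraph :: "'a multigraph \<Rightarrow> bool" where
  "loopless_multigraph G \<longleftrightarrow>
     finite (verts G) \<and> (\<forall>e \<in># edges G. e \<subseteq> verts G \<and> card e = 2)"

definition vertex_degree :: "'a multigraph \<Rightarrow> 'a \<Rightarrow> nat" where
  "vertex_degree G v = size {#e \<in># edges G. v \<in> e#}"

text \<open>The maximum degree of the graph without vertices is taken to be 0.\<close>

definition max_degree :: "'a multigraph \<Rightarrow> nat" where
  "max_degree G = Max (insert 0 (vertex_degree G ` verts G))"

definition del_vertex :: "'a multigraph \<Rightarrow> 'a \<Rightarrow> 'a multigraph" where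
  "del_vertex G v = \<lparr>verts = verts G - {v}, edges = {#e \<in># edges G. v \<notin> e#}\<rparr>"

definition induced_subgraph :: "'a multigraph \<Rightarrow> 'a set \<Rightarrow> 'a multigraph" where
  "induced_subgraph G S = \<lparr>verts = S, edges = {#e \<in># edges G. e \<subseteq> S#}\<rparr>"

definition k_independent :: "nat \<Rightarrow> 'a multigraph \<Rightarrow> 'a set \<Rightarrow> bool" where
  "k_independent k G S \<longleftrightarrow> S \<subseteq> verts G \<and> max_degree (induced_subgraph G S) < k"

definition degree_sequence :: "'a multigraph \<Rightarrow> nat multiset" where
  "degree_sequence G = image_mset (vertex_degree G) (mset_set (verts G))"

text \<open>Since vertex sets are finite, graphs on natural numbers realise all degree sequences.\<close>

definition is_degree_sequence :: "nat multiset \<Rightarrow> bool" where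
  "is_degree_sequence D \<longleftrightarrow>
     (\<exists>G :: nat multigraph. loopless_multigraph G \<and> degree_sequence G = D)"

text \<open>\<open>MAX_result k G S\<close> holds iff some run of MAX on \<open>G\<close> (for some choice of the maximum degree
  vertices) returns \<open>S\<close>.\<close>

inductive MAX_result :: "nat \<Rightarrow> 'a multigraph \<Rightarrow> 'a set \<Rightarrow> bool" for k where
  stop: "max_degree H < k \<Longrightarrow> MAX_result k H (verts H)"
| delete: "max_degree H \<ge> k \<Longrightarrow> v \<in> verts H \<Longrightarrow> vertex_degree H v = max_degree H \<Longrightarrow>
     MAX_result k (del_vertex H v) S \<Longrightarrow> MAX_result k H S"

text \<open>Every run can be continued until it stops, and it does stop: for positive \<open>k\<close> a vertex can
  be chosen whenever the maximum degree is at least \<open>k\<close>, and each deletion decreases the number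
  of vertices. So quantifying over the completed runs quantifies over all runs.\<close>

lemma MAX_progress:
  assumes "loopless_multigraph H" "k > 0" "max_degree H \<ge> k"
  shows "\<exists>v \<in> verts H. vertex_degree H v = max_degree H"
proof -
  have "max_degree H \<in> insert 0 (vertex_degree H ` verts H)"
    unfolding max_degree_def using assms(1)
    by (intro Max_in) (auto simp: loopless_multigraph_def)
  then show ?thesis using assms(2,3) by auto
qed

lemma MAX_terminates:
  assumes "loopless_multigraph H" "v \<in> verts H"
  shows "loopless_multigraph (del_vertex H v)"
    and "card (verts (del_vertex H v)) < card (verts H)"
proof -
  show "loopless_multigraph (del_vertex H v)"
    using assms by (auto simp: loopless_multigraph_def del_vertex_def)
  have "finite (verts H)" using assms(1) by (simp add: loopless_multigraph_def)
  then show "card (verts (del_vertex H v)) < card (verts H)"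
    using assms(2) by (simp add: del_vertex_def card_Diff1_less del: card_Diff_insert card_Diff_singleton)
qed

definition trivial_seq :: "nat \<Rightarrow> nat multiset \<Rightarrow> bool" where
  "trivial_seq k D \<longleftrightarrow> D = {#} \<or> Max_mset D < k"

definition decrement :: "nat \<Rightarrow> nat multiset \<Rightarrow> nat multiset" where
  "decrement x X = (X - {#x#}) + {#x - 1#}"

definition next_multiset :: "nat \<Rightarrow> nat multiset \<Rightarrow> nat multiset" where
  "next_multiset k A =
     decrement (if Max_mset A > k then Max_mset A else Min {x \<in> set_mset A. x > 0}) A"

text \<open>Here \<open>(next_multiset k ^^ i) A0\<close> is the multiset \<open>A\<^sub>i\<close> of the definition of
  \<open>\<Omega>(D)\<close>. In the last case the maximum of \<open>D\<close> is less than the sum of \<open>A0\<close>, so every multiset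
  that is decremented has a positive element.\<close>

definition Omega :: "nat \<Rightarrow> nat multiset \<Rightarrow> nat multiset" where
  "Omega k D =
     (let A0 = D - {#Max_mset D#} in
      if \<Sum>\<^sub># A0 < Max_mset D + 2 * k \<or> Max_mset A0 < k
      then replicate_mset (size D - 1) 0
      else (next_multiset k ^^ Max_mset D) A0)"

definition b_bound :: "nat \<Rightarrow> nat multiset \<Rightarrow> nat" where
  "b_bound k D = size ((Omega k ^^ (LEAST p. trivial_seq k ((Omega k ^^ p) D))) D)"

text \<open>The least number above exists and is at most the order of \<open>D\<close>, because \<open>Omega\<close> decreases
  the order by one. Hence \<open>Omega\<close> is never applied to the empty multiset.\<close>

lemma next_multiset_size_sum:
  assumes "\<Sum>\<^sub># A > 0"
  shows "size (next_multiset k A) = size A \<and> Suc (\<Sum>\<^sub># (next_multiset k A)) = \<Sum>\<^sub># A"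
proof -
  define a where "a = (if Max_mset A > k then Max_mset A else Min {x \<in> set_mset A. x > 0})"
  have "\<exists>x \<in># A. x > 0" using assms by (metis not_gr_zero sum_mset_0_iff)
  then have ne: "{x \<in> set_mset A. x > 0} \<noteq> {}" and ne': "set_mset A \<noteq> {}" by auto
  have "Min {x \<in> set_mset A. x > 0} \<in> {x \<in> set_mset A. x > 0}"
    using ne by (intro Min_in) auto
  moreover have "Max_mset A \<in> set_mset A" using ne' by (intro Max_in) auto
  ultimately have a: "a \<in># A" "a > 0" unfolding a_def by auto
  then obtain B where "A = add_mset a B" by (meson multi_member_split)
  then show ?thesis
    using a(2) unfolding next_multiset_def a_def[symmetric] decrement_def by simp
qed

lemma size_Omega:
  assumes "D \<noteq> {#}" "k > 0"
  shows "size (Omega k D) = size D - 1"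
proof -
  define A0 where "A0 = D - {#Max_mset D#}"
  have size: "size A0 = size D - 1"
    unfolding A0_def using assms(1) by (simp add: size_Diff_singleton)
  have iter: "size ((next_multiset k ^^ i) A0) = size A0 \<and>
      \<Sum>\<^sub># ((next_multiset k ^^ i) A0) + i = \<Sum>\<^sub># A0" if "i \<le> \<Sum>\<^sub># A0" for i
    using that
  proof (induction i)
    case (Suc i)
    then have "\<Sum>\<^sub># ((next_multiset k ^^ i) A0) > 0" by auto
    from next_multiset_size_sum[OF this, of k] Suc show ?case by auto
  qed simp
  show ?thesis
    unfolding Omega_def Let_def A0_def[symmetric] using size iter by auto
qed

lemma Omega_trivial_exists:
  assumes "k > 0"
  shows "\<exists>p \<le> size D. trivial_seq k ((Omega k ^^ p) D)"
proof (induction "size D" arbitrary: D)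
  case 0
  then show ?case by (auto simp: trivial_seq_def)
next
  case (Suc n)
  then have "D \<noteq> {#}" by auto
  then have "n = size (Omega k D)" using size_Omega[OF _ assms] Suc(2) by auto
  from Suc(1)[OF this] obtain p where
    "p \<le> n" "trivial_seq k ((Omega k ^^ p) (Omega k D))" using \<open>n = _\<close> by auto
  then show ?case
    using Suc(2) by (intro exI[of _ "Suc p"]) (simp add: funpow_swap1)
qed

end

theory Submission
  imports Defs
begin

text \<open>For \<open>M \<ge> k\<close> let \<open>T\<^sub>M(D)\<close> be the sum of \<open>min a M\<close> over the elements \<open>a\<close> of \<open>D\<close>, and say that
  \<open>D\<close> dominates \<open>E\<close> if \<open>T\<^sub>M(E) \<le> T\<^sub>M(D)\<close> for all \<open>M \<ge> k\<close>, \<open>D\<close> has at least as many elements \<open>\<ge> k\<close> as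
  \<open>E\<close>, and \<open>\<Sum>E - 2 max E \<le> \<Sum>D - 2 max D\<close>. Removing a vertex of maximum degree \<open>d\<close> from a graph
  leaves a degree sequence \<open>D'\<close> of sum \<open>\<Sum>D - 2 d\<close>, and both \<open>T\<^sub>M(A\<^sub>0)\<close> and this sum bound \<open>T\<^sub>M(D')\<close>
  from above. For \<open>\<Omega>\<close> the smaller of the two bounds is attained for every \<open>M \<ge> k\<close>, because
  elements above \<open>k\<close> are lowered from the top. Hence domination of the degree sequence of the current
  graph by the iterate of \<open>\<Omega>\<close> persists along every run of MAX until the run stops, and a
  dominated sequence is trivial if the dominating one is. For the inequality on the maxima, parity is
  decisive: if the maximum of \<open>\<Omega>(D)\<close> exceeds \<open>k\<close>, some other element is at most one smaller.

  The bound is attained since \<open>\<Omega>(D)\<close> is realisable (it has even sum and no element exceeds half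
  the sum), and the decrements prescribe how to attach a vertex of degree \<open>max D\<close> to a
  realisation.\<close>

section \<open>Truncated sums, heavy elements and domination\<close>

definition trunc_sum :: "nat \<Rightarrow> nat multiset \<Rightarrow> nat" where
  "trunc_sum M A = (\<Sum>a\<in>#A. min a M)"

definition heavy :: "nat \<Rightarrow> nat multiset \<Rightarrow> nat" where
  "heavy k A = size {#a \<in># A. k \<le> a#}"

text \<open>The inequality on the maxima is stated additively, since natural subtraction would cut
  off negative differences. Evenness is recorded for the parity argument.\<close>

definition dominates :: "nat \<Rightarrow> nat multiset \<Rightarrow> nat multiset \<Rightarrow> bool" where
  "dominates k D E \<longleftrightarrow>
     even (\<Sum>\<^sub># D) \<and> even (\<Sum>\<^sub># E) \<and>
     (\<forall>M\<ge>k. trunc_sum M E \<le> trunc_sum M D) \<and>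
     \<Sum>\<^sub># E + 2 * Max_mset D \<le> \<Sum>\<^sub># D + 2 * Max_mset E \<and>
     heavy k E \<le> heavy k D"

text \<open>What the comparison uses about the degree sequences before and after the deletion of a vertex of
  maximum degree.\<close>

definition deletion_step :: "nat multiset \<Rightarrow> nat multiset \<Rightarrow> bool" where
  "deletion_step D D' \<longleftrightarrow>
     (\<exists>A. D = add_mset (Max_mset D) A \<and>
        (\<forall>M. trunc_sum M D' \<le> trunc_sum M A) \<and> (\<forall>k. heavy k D' \<le> heavy k A)) \<and>
     \<Sum>\<^sub># D' + 2 * Max_mset D = \<Sum>\<^sub># D \<and> even (\<Sum>\<^sub># D') \<and> (\<forall>x\<in>#D'. 2 * x \<le> \<Sum>\<^sub># D')"

lemma trunc_sum_simps [simp]: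
  "trunc_sum M {#} = 0"
  "trunc_sum M (add_mset a A) = min a M + trunc_sum M A"
  by (simp_all add: trunc_sum_def)

lemma heavy_simps [simp]:
  "heavy k {#} = 0"
  "heavy k (add_mset a A) = (if k \<le> a then 1 else 0) + heavy k A"
  by (simp_all add: heavy_def)

lemma trunc_sum_le_sum: "trunc_sum M A \<le> \<Sum>\<^sub># A"
  by (induction A) auto

lemma trunc_sum_eq_sum: "(\<And>a. a \<in># A \<Longrightarrow> a \<le> M) \<Longrightarrow> trunc_sum M A = \<Sum>\<^sub># A"
  by (induction A) auto

lemma trunc_sum_mono: "M \<le> N \<Longrightarrow> trunc_sum M A \<le> trunc_sum N A"
  by (induction A) (auto intro!: add_mono)

lemma heavy_mult_le_sum: "heavy k A * k \<le> \<Sum>\<^sub># A"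
  by (induction A) auto

lemma heavy_eq_0_iff: "heavy k A = 0 \<longleftrightarrow> (\<forall>a\<in>#A. a < k)"
  by (induction A) auto

lemma trivial_seq_iff: "trivial_seq k D \<longleftrightarrow> (\<forall>a\<in>#D. a < k)"
  by (cases "D = {#}") (auto simp: trivial_seq_def)

lemma trivial_seq_iff_heavy: "trivial_seq k D \<longleftrightarrow> heavy k D = 0"
  by (simp add: trivial_seq_iff heavy_eq_0_iff)

section \<open>Invariants of iterated decrements\<close>

lemma Max_mset_add_mset_eq:
  "(\<And>z. z \<in># C \<Longrightarrow> z \<le> x) \<Longrightarrow> Max_mset (add_mset x C) = x"
  by (intro Max_eqI) auto

text \<open>The alternatives are the two phases of the process: lowering the top while it exceeds
  \<open>k\<close>, then wearing down the smallest positive element.\<close>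

lemma next_multiset_cases:
  assumes "\<Sum>\<^sub># B > 0"
  obtains a C where "B = add_mset a C" "a > 0" "next_multiset k B = add_mset (a - 1) C"
    "(k < a \<and> (\<forall>x\<in>#C. x \<le> a)) \<or> ((\<forall>x\<in>#B. x \<le> k) \<and> (\<forall>x\<in>#C. x = 0 \<or> a \<le> x))"
proof -
  define a where "a = (if Max_mset B > k then Max_mset B else Min {x \<in> set_mset B. x > 0})"
  have "\<exists>x \<in># B. x > 0" using assms by (metis not_gr_zero sum_mset_0_iff)
  then have ne: "{x \<in> set_mset B. x > 0} \<noteq> {}" and ne': "set_mset B \<noteq> {}" by auto
  have "Min {x \<in> set_mset B. x > 0} \<in> {x \<in> set_mset B. x > 0}"
    using ne by (intro Min_in) auto
  moreover have "Max_mset B \<in> set_mset B" using ne' by (intro Max_in) auto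
  ultimately have a: "a \<in># B" "a > 0" unfolding a_def by auto
  then obtain C where C: "B = add_mset a C" by (meson multi_member_split)
  have nx: "next_multiset k B = add_mset (a - 1) C"
    unfolding next_multiset_def a_def[symmetric] decrement_def by (simp add: C)
  have sub: "x \<in># B" if "x \<in># C" for x using that C by auto
  have "(k < a \<and> (\<forall>x\<in>#C. x \<le> a)) \<or> ((\<forall>x\<in>#B. x \<le> k) \<and> (\<forall>x\<in>#C. x = 0 \<or> a \<le> x))"
  proof (cases "Max_mset B > k")
    case True
    then have "a = Max_mset B" by (simp add: a_def)
    then have "k < a \<and> (\<forall>x\<in>#C. x \<le> a)" using True sub by auto
    then show ?thesis by blast
  next
    case False
    then have "a = Min {x \<in> set_mset B. x > 0}" by (simp add: a_def)
    moreover have "Min {x \<in> set_mset B. x > 0} \<le> x" if "x \<in># C" "x \<noteq> 0" for x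
      using that sub by (intro Min_le) auto
    ultimately have "\<forall>x\<in>#C. x = 0 \<or> a \<le> x" by blast
    moreover have "\<forall>x\<in>#B. x \<le> k"
      using False by (meson Max_ge finite_set_mset le_trans not_less)
    ultimately show ?thesis by blast
  qed
  then show thesis using that[OF C a(2) nx] by blast
qed

lemma sum_mset_funpow_next_multiset:
  assumes "i \<le> \<Sum>\<^sub># A"
  shows "\<Sum>\<^sub># ((next_multiset k ^^ i) A) + i = \<Sum>\<^sub># A"
  using assms
proof (induction i)
  case (Suc i)
  then have "\<Sum>\<^sub># ((next_multiset k ^^ i) A) > 0" by auto
  from next_multiset_size_sum[OF this, of k] Suc show ?case by auto
qed simp

text \<open>A decrement of an element above \<open>M\<close> leaves the truncated sum unchanged. The
  first decrement of an element at most \<open>M\<close> finds every element at most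
  \<open>M\<close>, and from then on truncation loses nothing.\<close>

lemma trunc_sum_funpow_next_multiset:
  assumes "i \<le> \<Sum>\<^sub># A" "k \<le> M"
  shows "min (trunc_sum M A) (\<Sum>\<^sub># ((next_multiset k ^^ i) A))
           \<le> trunc_sum M ((next_multiset k ^^ i) A)"
  using assms(1)
proof (induction i)
  case 0
  show ?case using trunc_sum_le_sum by simp
next
  case (Suc i)
  let ?B = "(next_multiset k ^^ i) A"
  have "\<Sum>\<^sub># ?B > 0" using sum_mset_funpow_next_multiset[of i A k] Suc.prems by simp
  then obtain a C where B: "?B = add_mset a C" "a > 0" "next_multiset k ?B = add_mset (a - 1) C"
    and ac: "(k < a \<and> (\<forall>x\<in>#C. x \<le> a)) \<or> ((\<forall>x\<in>#?B. x \<le> k) \<and> (\<forall>x\<in>#C. x = 0 \<or> a \<le> x))"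
    using next_multiset_cases by blast
  show ?case
  proof (cases "M < a")
    case True
    then have "trunc_sum M (next_multiset k ?B) = trunc_sum M ?B" using B by simp
    then show ?thesis using Suc B by simp
  next
    case False
    then have "\<forall>x\<in>#next_multiset k ?B. x \<le> M" using ac B assms(2) by fastforce
    then have "trunc_sum M (next_multiset k ?B) = \<Sum>\<^sub># (next_multiset k ?B)"
      using trunc_sum_eq_sum by blast
    then show ?thesis by simp
  qed
qed

lemma sum_mset_le_heavy_mult:
  "(\<And>x. x \<in># C \<Longrightarrow> x = 0 \<or> x = k) \<Longrightarrow> \<Sum>\<^sub># C \<le> heavy k C * k"
proof (induction C)
  case (add x C)
  then have "\<Sum>\<^sub># C \<le> heavy k C * k" "x = 0 \<or> x = k" by auto
  then show ?case by auto
qed simp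

text \<open>Only decrementing an element equal to \<open>k\<close> lowers the count. That happens
  only when every positive element equals \<open>k\<close>, and then the new count is the largest
  that the new sum allows. Further decrements preserve this.\<close>

lemma heavy_funpow_next_multiset:
  assumes "i \<le> \<Sum>\<^sub># A"
  shows "heavy k ((next_multiset k ^^ i) A) = heavy k A \<or>
    \<Sum>\<^sub># ((next_multiset k ^^ i) A) < Suc (heavy k ((next_multiset k ^^ i) A)) * k"
  using assms
proof (induction i)
  case (Suc i)
  let ?B = "(next_multiset k ^^ i) A"
  have "\<Sum>\<^sub># ?B > 0" using sum_mset_funpow_next_multiset[of i A k] Suc.prems by simp
  then obtain a C where B: "?B = add_mset a C" "a > 0" "next_multiset k ?B = add_mset (a - 1) C"
    and ac: "(k < a \<and> (\<forall>x\<in>#C. x \<le> a)) \<or> ((\<forall>x\<in>#?B. x \<le> k) \<and> (\<forall>x\<in>#C. x = 0 \<or> a \<le> x))"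
    using next_multiset_cases by blast
  show ?case
  proof (cases "a = k")
    case True
    then have "x = 0 \<or> x = k" if "x \<in># C" for x
      using ac that B(1) by fastforce
    then have "\<Sum>\<^sub># C \<le> heavy k C * k" by (rule sum_mset_le_heavy_mult)
    moreover have "heavy k (next_multiset k ?B) = heavy k C"
      "\<Sum>\<^sub># (next_multiset k ?B) < k + \<Sum>\<^sub># C"
      unfolding B(3) using B(2) True by simp_all
    ultimately have "\<Sum>\<^sub># (next_multiset k ?B) < Suc (heavy k (next_multiset k ?B)) * k" by simp
    then show ?thesis by simp
  next
    case False
    then have "heavy k (next_multiset k ?B) = heavy k ?B" using B by auto
    moreover have "\<Sum>\<^sub># (next_multiset k ?B) < \<Sum>\<^sub># ?B" using B by simp
    ultimately show ?thesis using Suc by auto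
  qed
qed simp

text \<open>As long as decrements hit a unique maximum, it decreases with \<open>i\<close>; once it meets a second
  element, the two stay within distance one.\<close>

lemma top_two_funpow_next_multiset:
  assumes "i \<le> \<Sum>\<^sub># A"
  shows "(\<forall>x\<in>#(next_multiset k ^^ i) A. x \<le> k) \<or>
    (\<exists>x C. (next_multiset k ^^ i) A = add_mset x C \<and> (\<forall>z\<in>#C. z \<le> x) \<and>
       (x + i \<le> Max_mset A \<or> (\<exists>y\<in>#C. x \<le> Suc y)))"
  using assms
proof (induction i)
  case 0
  show ?case
  proof (cases "A = {#}")
    case False
    then have "Max_mset A \<in># A" by (intro Max_in) auto
    then obtain C where C: "A = add_mset (Max_mset A) C" by (meson multi_member_split)
    moreover have "\<forall>z\<in>#C. z \<le> Max_mset A"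
      using C by (metis Max_ge finite_set_mset insert_iff set_mset_add_mset_insert)
    ultimately show ?thesis by auto
  qed simp
next
  case (Suc i)
  let ?B = "(next_multiset k ^^ i) A"
  have "\<Sum>\<^sub># ?B > 0" using sum_mset_funpow_next_multiset[of i A k] Suc.prems by simp
  then obtain a C where B: "?B = add_mset a C" "a > 0" "next_multiset k ?B = add_mset (a - 1) C"
    and ac: "(k < a \<and> (\<forall>x\<in>#C. x \<le> a)) \<or> ((\<forall>x\<in>#?B. x \<le> k) \<and> (\<forall>x\<in>#C. x = 0 \<or> a \<le> x))"
    using next_multiset_cases by blast
  show ?case
  proof (cases "\<forall>x\<in>#?B. x \<le> k")
    case True
    then have "\<forall>x\<in>#next_multiset k ?B. x \<le> k" using B by auto
    then show ?thesis by simp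
  next
    case False
    with ac have aC: "k < a" "\<forall>x\<in>#C. x \<le> a" by auto
    from False Suc obtain x C' where x: "?B = add_mset x C'" "\<forall>z\<in>#C'. z \<le> x"
      "x + i \<le> Max_mset A \<or> (\<exists>y\<in>#C'. x \<le> Suc y)"
      using Suc_leD by blast
    have "x = a"
      using x B(1) aC(2) by (metis Max_mset_add_mset_eq)
    then have C': "C' = C" using x B(1) by simp
    show ?thesis
    proof (cases "a \<in># C")
      case True
      then obtain C2 where C2: "C = add_mset a C2" by (meson multi_member_split)
      \<comment> \<open>The untouched copy of \<open>a\<close> stays on top, and the lowered copy
        \<open>a - 1\<close> is its neighbour.\<close>
      have "(next_multiset k ^^ Suc i) A = add_mset a (add_mset (a - 1) C2)"
        using B C2 by (simp add: add_mset_commute)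
      then show ?thesis using aC C2 by (intro disjI2 exI[of _ a] exI[of _ "add_mset (a - 1) C2"]) auto
    next
      case False
      \<comment> \<open>Here \<open>a\<close> was the unique maximum, so the maximum falls by one
        along with this decrement.\<close>
      then have "\<forall>z\<in>#C. z \<le> a - 1" using aC by (metis Suc_diff_1 B(2) le_SucE)
      moreover have "a - 1 + Suc i \<le> Max_mset A \<or> (\<exists>y\<in>#C. a - 1 \<le> Suc y)"
        using x(3) \<open>x = a\<close> C' B(2) by fastforce
      ultimately show ?thesis using B by (intro disjI2 exI[of _ "a - 1"] exI[of _ C]) auto
    qed
  qed
qed

section \<open>Recursion for the bound\<close>

lemma b_bound_trivial: "trivial_seq k D \<Longrightarrow> b_bound k D = size D"
  unfolding b_bound_def by (subst Least_equality[of _ 0]) auto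

text \<open>Replaces the \<open>LEAST\<close> by a recursion along \<open>Omega\<close>, which suits
  induction on the order of \<open>D\<close> or along a run of MAX.\<close>

lemma b_bound_Omega:
  assumes "k > 0" "\<not> trivial_seq k D"
  shows "b_bound k D = b_bound k (Omega k D)"
proof -
  obtain p where p: "trivial_seq k ((Omega k ^^ p) D)" using Omega_trivial_exists[OF assms(1)] by blast
  have "(LEAST p. trivial_seq k ((Omega k ^^ p) D)) =
        Suc (LEAST p. trivial_seq k ((Omega k ^^ Suc p) D))"
    by (rule Least_Suc[where P = "\<lambda>p. trivial_seq k ((Omega k ^^ p) D)", OF p]) (use assms in simp)
  then show ?thesis unfolding b_bound_def by (simp add: funpow_Suc_right del: funpow.simps(2))
qed

text \<open>Serves the moment when MAX stops and returns all remaining vertices, as many as the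
  current sequence has elements.\<close>

lemma b_bound_le_size:
  assumes "k > 0"
  shows "b_bound k D \<le> size D"
proof (induction "size D" arbitrary: D rule: less_induct)
  case less
  show ?case
  proof (cases "trivial_seq k D")
    case False
    then have "D \<noteq> {#}" by (auto simp: trivial_seq_def)
    then have "size (Omega k D) < size D"
      using size_Omega[OF _ assms] by (simp add: nonempty_has_size)
    then show ?thesis using less b_bound_Omega[OF assms False] by fastforce
  qed (simp add: b_bound_trivial)
qed

section \<open>Domination survives one deletion\<close>

text \<open>The hypotheses put \<open>Omega\<close> in its last case, with the bound on the sum
  transferred from \<open>A\<close> to \<open>D\<close>. The invariants of the decrements are then
  read off after \<open>Max_mset D\<close> steps.\<close>

lemma Omega_nontrivial:
  fixes k D A
  defines "B \<equiv> (next_multiset k ^^ Max_mset D) A"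
  assumes "D = add_mset (Max_mset D) A" "even (\<Sum>\<^sub># D)" "heavy k A > 0"
    and "\<Sum>\<^sub># D \<ge> 2 * Max_mset D + 2 * k"
  shows "Omega k D = B"
    and "\<Sum>\<^sub># B + 2 * Max_mset D = \<Sum>\<^sub># D"
    and "\<And>M. M \<ge> k \<Longrightarrow> min (trunc_sum M A) (\<Sum>\<^sub># B) \<le> trunc_sum M B"
    and "heavy k B = heavy k A \<or> \<Sum>\<^sub># B < Suc (heavy k B) * k"
    and "(\<forall>x\<in>#B. x \<le> k) \<or>
         (\<exists>x y C. B = add_mset x (add_mset y C) \<and> x = Max_mset B \<and> x \<le> Suc y)"
proof -
  have sumA: "\<Sum>\<^sub># A + Max_mset D = \<Sum>\<^sub># D"
    by (subst (2) assms(2)) simp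
  have A: "A = D - {#Max_mset D#}" by (metis add_mset_remove_trivial assms(2))
  have "\<not> Max_mset A < k"
    using assms(4) by (metis bot_nat_0.not_eq_extremum trivial_seq_def trivial_seq_iff_heavy)
  then show "Omega k D = B"
    unfolding Omega_def B_def A[symmetric] Let_def using sumA assms(5) by simp
  have le: "Max_mset D \<le> \<Sum>\<^sub># A" using sumA assms(5) by simp
  show sB: "\<Sum>\<^sub># B + 2 * Max_mset D = \<Sum>\<^sub># D"
    unfolding B_def using sum_mset_funpow_next_multiset[OF le, of k] sumA by simp
  show "min (trunc_sum M A) (\<Sum>\<^sub># B) \<le> trunc_sum M B" if "M \<ge> k" for M
    unfolding B_def using trunc_sum_funpow_next_multiset[OF le that] .
  show "heavy k B = heavy k A \<or> \<Sum>\<^sub># B < Suc (heavy k B) * k"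
    unfolding B_def using heavy_funpow_next_multiset[OF le] .
  have "A \<noteq> {#}" using assms(4) by auto
  then have "Max_mset A \<in># A" by (intro Max_in) auto
  then have "Max_mset A \<in># D" by (subst assms(2)) simp
  then have mle: "Max_mset A \<le> Max_mset D" by simp
  show "(\<forall>x\<in>#B. x \<le> k) \<or>
         (\<exists>x y C. B = add_mset x (add_mset y C) \<and> x = Max_mset B \<and> x \<le> Suc y)"
  proof (cases "\<forall>x\<in>#B. x \<le> k")
    case True
    then show ?thesis by blast
  next
    case False
    with top_two_funpow_next_multiset[OF le, of k, folded B_def] obtain x C where
      x: "B = add_mset x C" "\<forall>z\<in>#C. z \<le> x" "x + Max_mset D \<le> Max_mset A \<or> (\<exists>y\<in>#C. x \<le> Suc y)"
      by blast
    \<comment> \<open>A positive \<open>x\<close> refutes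
      \<open>x + Max_mset D \<le> Max_mset A\<close>, as \<open>Max_mset A \<le> Max_mset D\<close>:
      so many decrements must have met a second element.\<close>
    have "x > 0" using x(1,2) False by fastforce
    with mle x(3) obtain y where "y \<in># C" "x \<le> Suc y" by auto
    then obtain C' where "C = add_mset y C'" by (meson multi_member_split)
    moreover have "Max_mset B = x" unfolding x(1) using x(2) by (intro Max_mset_add_mset_eq) auto
    ultimately have "B = add_mset x (add_mset y C') \<and> x = Max_mset B \<and> x \<le> Suc y"
      using x(1) \<open>x \<le> Suc y\<close> by simp
    then show ?thesis by blast
  qed
qed

text \<open>Truncation at \<open>M\<close> removes \<open>x - M\<close> from \<open>x\<close> and at
  least \<open>x - M - 1\<close> from \<open>y\<close>.\<close>

lemma trunc_sum_top_two:
  assumes "B = add_mset x (add_mset y C)" "x \<le> Suc y" "M < x"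
  shows "trunc_sum M B + 2 * (x - M) \<le> Suc (\<Sum>\<^sub># B)"
  using assms trunc_sum_le_sum[of M C] by auto

text \<open>Lets one application of \<open>Omega\<close> keep pace with one deletion by MAX; the
  excluded case of a trivial \<open>E'\<close> is the end of the run.\<close>

lemma dominates_step:
  assumes dom: "dominates k D E" and step: "deletion_step E E'"
    and D: "\<not> trivial_seq k D" and E': "\<not> trivial_seq k E'"
  shows "dominates k (Omega k D) E'"
proof -
  obtain A2 where A2: "E = add_mset (Max_mset E) A2"
    "\<And>M. trunc_sum M E' \<le> trunc_sum M A2" "\<And>k. heavy k E' \<le> heavy k A2"
    using step unfolding deletion_step_def by blast
  define d e where "d = Max_mset D" and "e = Max_mset E"
  note A2 = A2[folded e_def]
  have st: "\<Sum>\<^sub># E' + 2 * e = \<Sum>\<^sub># E" "even (\<Sum>\<^sub># E')" "\<And>x. x \<in># E' \<Longrightarrow> 2 * x \<le> \<Sum>\<^sub># E'"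
    using step unfolding deletion_step_def e_def by auto
  have dm: "even (\<Sum>\<^sub># D)" "\<And>M. M \<ge> k \<Longrightarrow> trunc_sum M E \<le> trunc_sum M D"
    "\<Sum>\<^sub># E + 2 * d \<le> \<Sum>\<^sub># D + 2 * e" "heavy k E \<le> heavy k D"
    using dom unfolding dominates_def d_def e_def by auto
  have "D \<noteq> {#}" using D by (auto simp: trivial_seq_def)
  then have "d \<in># D" unfolding d_def by (intro Max_in) auto
  then obtain A where A: "D = add_mset d A" by (meson multi_member_split)
  have "d \<ge> k" using D unfolding trivial_seq_def d_def by simp
  define e' where "e' = Max_mset E'"
  have e': "e' \<in># E'" "k \<le> e'"
    using E' unfolding trivial_seq_def e'_def by (auto intro!: Max_in)
  have hE': "heavy k E' > 0" using E' by (simp add: trivial_seq_iff_heavy)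
  have ee: "e \<ge> k"
  proof -
    have "heavy k A2 > 0" using hE' A2(3)[of k] by simp
    then obtain x where "x \<in># A2" "k \<le> x" by (metis heavy_eq_0_iff less_irrefl not_le)
    then have "x \<in># E" using A2(1) by (metis insert_iff set_mset_add_mset_insert)
    then have "x \<le> e" unfolding e_def by simp
    then show ?thesis using \<open>k \<le> x\<close> by simp
  qed
  have "heavy k E = Suc (heavy k A2)" by (subst A2(1)) (use ee in simp)
  moreover have "heavy k D = Suc (heavy k A)" by (subst A) (use \<open>d \<ge> k\<close> in simp)
  ultimately have hA: "heavy k E' \<le> heavy k A" using dm(4) A2(3)[of k] by simp
  \<comment> \<open>Some degree is at least \<open>k\<close> and no degree exceeds half of the sum.
    The inequality on the maxima passes this bound to \<open>D\<close> and so puts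
    \<open>Omega\<close> in its last case.\<close>
  have sE': "2 * k \<le> \<Sum>\<^sub># E'" using st(3)[OF e'(1)] e'(2) by simp
  have big: "2 * Max_mset D + 2 * k \<le> \<Sum>\<^sub># D" using dm(3) st(1) sE' unfolding d_def[symmetric] by linarith
  note Om = Omega_nontrivial[OF A[unfolded d_def] dm(1) _ big, folded d_def]
  have hpos: "0 < heavy k A" using hA hE' by simp
  define B where "B = Omega k D"
  note Om = Om(2-5)[OF hpos, folded Om(1)[OF hpos], folded B_def]
  have evB: "even (\<Sum>\<^sub># B)" using Om(1) dm(1) by (metis dvd_triv_left even_add)
  have sB: "\<Sum>\<^sub># E' \<le> \<Sum>\<^sub># B" using Om(1) st(1) dm(3) by linarith
  have tr: "trunc_sum M E' \<le> trunc_sum M B" if M: "M \<ge> k" for M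
  proof -
    have "trunc_sum M E' \<le> trunc_sum M A"
    \<comment> \<open>If \<open>D\<close> loses no more than \<open>E\<close> at level
      \<open>M\<close>, subtract. Otherwise \<open>e < d\<close> and \<open>e < M\<close>; level
      \<open>e\<close> cuts nothing off \<open>E\<close>, so comparing there bounds even the full
      \<open>\<Sum>\<^sub># E'\<close> by \<open>trunc_sum e A\<close>.\<close>
    proof (cases "min d M \<le> min e M")
      case True
      have "trunc_sum M E = min e M + trunc_sum M A2" by (subst A2(1)) simp
      moreover have "trunc_sum M D = min d M + trunc_sum M A" by (subst A) simp
      ultimately show ?thesis using dm(2)[OF M] A2(2)[of M] True by simp
    next
      case False
      have "trunc_sum e D = e + trunc_sum e A" by (subst A) (use False in simp)
      moreover have "trunc_sum e E = \<Sum>\<^sub># E" unfolding e_def by (rule trunc_sum_eq_sum) simp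
      moreover have "trunc_sum e A \<le> trunc_sum M A" using False by (intro trunc_sum_mono) auto
      ultimately show ?thesis
        using dm(2)[OF ee] st(1) trunc_sum_le_sum[of M E'] by linarith
    qed
    moreover have "trunc_sum M E' \<le> \<Sum>\<^sub># B" using trunc_sum_le_sum[of M E'] sB by simp
    ultimately show ?thesis using Om(2)[OF M] by simp
  qed
  have hv: "heavy k E' \<le> heavy k B"
  proof (cases "heavy k B = heavy k A")
    \<comment> \<open>The count in \<open>B\<close> is now the largest that its sum allows, and
      \<open>E'\<close> has no larger sum.\<close>
    case False
    then have "heavy k E' * k < Suc (heavy k B) * k"
      using Om(3) sB heavy_mult_le_sum[of k E'] by linarith
    then show ?thesis by (simp only: mult_less_cancel2) simp
  qed (use hA in simp)
  have mx: "\<Sum>\<^sub># E' + 2 * Max_mset B \<le> \<Sum>\<^sub># B + 2 * e'"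
  proof (cases "Max_mset B \<le> e'")
    \<comment> \<open>Some other element of \<open>B\<close> is at most one below the maximum.
      Comparing truncated sums at level \<open>e'\<close>, which leaves \<open>E'\<close> intact,
      gives the inequality up to an error of one.\<close>
    case False
    have "B \<noteq> {#}" using hv hE' by auto
    then have "Max_mset B \<in># B" by (intro Max_in) auto
    then have "\<not> (\<forall>x\<in>#B. x \<le> k)" using False e'(2) by (meson le_trans)
    then obtain y C where B: "B = add_mset (Max_mset B) (add_mset y C)" "Max_mset B \<le> Suc y"
      using Om(4) by metis
    have "trunc_sum e' B + 2 * (Max_mset B - e') \<le> Suc (\<Sum>\<^sub># B)"
      using trunc_sum_top_two[OF B] False by simp
    moreover have "trunc_sum e' E' = \<Sum>\<^sub># E'" unfolding e'_def by (rule trunc_sum_eq_sum) simp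
    ultimately have "\<Sum>\<^sub># E' + 2 * (Max_mset B - e') \<le> Suc (\<Sum>\<^sub># B)" using tr[OF e'(2)] by simp
    \<comment> \<open>Both sums are even, which removes the error of one.\<close>
    then show ?thesis using evB st(2) False by presburger
  qed (use sB in simp)
  show ?thesis unfolding dominates_def B_def[symmetric] e'_def[symmetric]
    using evB st(2) tr mx hv by blast
qed

section \<open>Degree sequences and vertex deletion\<close>

lemma loopless_handshake:
  assumes "finite V" "\<forall>e\<in>#E. e \<subseteq> V \<and> card e = 2"
  shows "(\<Sum>v\<in>V. size {#e \<in># E. v \<in> e#}) = 2 * size E"
  using assms(2)
proof (induction E)
  case (add e E)
  have "(\<Sum>v\<in>V. size {#x \<in># add_mset e E. v \<in> x#}) =
        (\<Sum>v\<in>V. (if v \<in> e then 1 else 0) + size {#x \<in># E. v \<in> x#})"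
    by (intro sum.cong) auto
  also have "\<dots> = card e + 2 * size E"
    using add assms(1) by (simp add: sum.distrib sum.If_cases Int_absorb1)
  finally show ?case using add by simp
qed simp

lemma sum_degree_sequence:
  assumes "loopless_multigraph G"
  shows "\<Sum>\<^sub># (degree_sequence G) = 2 * size (edges G)"
proof -
  have "\<Sum>\<^sub># (degree_sequence G) = (\<Sum>v\<in>verts G. vertex_degree G v)"
    by (simp add: degree_sequence_def sum_unfold_sum_mset)
  then show ?thesis
    using assms loopless_handshake[of "verts G" "edges G"]
    by (simp add: loopless_multigraph_def vertex_degree_def)
qed

lemma max_degree_eq_Max_mset:
  assumes "verts G \<noteq> {}" "finite (verts G)"
  shows "max_degree G = Max_mset (degree_sequence G)"
  using assms by (simp add: max_degree_def degree_sequence_def)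

text \<open>Positivity of \<open>k\<close> covers the graph without vertices, whose maximum degree
  is 0.\<close>

lemma max_degree_less_iff:
  assumes "loopless_multigraph G" "k > 0"
  shows "max_degree G < k \<longleftrightarrow> trivial_seq k (degree_sequence G)"
  using assms by (auto simp: max_degree_def degree_sequence_def trivial_seq_iff loopless_multigraph_def)

lemma size_degree_sequence: "size (degree_sequence G) = card (verts G)"
  by (simp add: degree_sequence_def)

lemma vertex_degree_le_size: "vertex_degree G v \<le> size (edges G)"
  by (simp add: vertex_degree_def size_mset_mono)

lemma vertex_degree_del_vertex_le: "vertex_degree (del_vertex G v) w \<le> vertex_degree G w"
  by (auto simp: vertex_degree_def del_vertex_def intro!: size_mset_mono multiset_filter_mono)

lemma size_edges_del_vertex: "size (edges (del_vertex G v)) + vertex_degree G v = size (edges G)"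
proof -
  have "size (edges G) = size {#e \<in># edges G. v \<in> e#} + size {#e \<in># edges G. v \<notin> e#}"
    by (metis multiset_partition size_union)
  then show ?thesis by (simp add: vertex_degree_def del_vertex_def)
qed

lemma trunc_sum_image_mono:
  "(\<And>x. x \<in># V \<Longrightarrow> f x \<le> g x) \<Longrightarrow> trunc_sum M (image_mset f V) \<le> trunc_sum M (image_mset g V)"
proof (induction V)
  case (add x V)
  then have "trunc_sum M (image_mset f V) \<le> trunc_sum M (image_mset g V)" "f x \<le> g x" by simp_all
  then show ?case by simp
qed simp

lemma heavy_image_mono:
  "(\<And>x. x \<in># V \<Longrightarrow> f x \<le> g x) \<Longrightarrow> heavy k (image_mset f V) \<le> heavy k (image_mset g V)"
proof (induction V)
  case (add x V)
  then have "heavy k (image_mset f V) \<le> heavy k (image_mset g V)" "f x \<le> g x" by simp_all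
  then show ?case by simp
qed simp

text \<open>Take for \<open>A\<close> the old degrees of the surviving vertices: none of them rises.
  By the handshake identity half of the new sum is the number of edges, which no degree
  exceeds.\<close>

lemma deletion_step_del_vertex:
  assumes G: "loopless_multigraph G" and v: "v \<in> verts G" "vertex_degree G v = max_degree G"
  shows "deletion_step (degree_sequence G) (degree_sequence (del_vertex G v))"
proof -
  have fin: "finite (verts G)" using G by (simp add: loopless_multigraph_def)
  have mx: "Max_mset (degree_sequence G) = vertex_degree G v"
    using max_degree_eq_Max_mset[of G] v fin by fastforce
  have G': "loopless_multigraph (del_vertex G v)" using MAX_terminates[OF G v(1)] by blast
  define A where "A = image_mset (vertex_degree G) (mset_set (verts G - {v}))"
  have "mset_set (verts G) = add_mset v (mset_set (verts G - {v}))"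
    using fin v(1) by (rule mset_set.remove)
  then have "degree_sequence G = add_mset (Max_mset (degree_sequence G)) A"
    unfolding mx by (simp add: degree_sequence_def A_def)
  moreover have D': "degree_sequence (del_vertex G v) =
      image_mset (vertex_degree (del_vertex G v)) (mset_set (verts G - {v}))"
    by (simp add: degree_sequence_def del_vertex_def)
  then have "\<forall>M. trunc_sum M (degree_sequence (del_vertex G v)) \<le> trunc_sum M A"
    "\<forall>k. heavy k (degree_sequence (del_vertex G v)) \<le> heavy k A"
    unfolding A_def by (simp_all add: trunc_sum_image_mono heavy_image_mono vertex_degree_del_vertex_le)
  moreover have "\<forall>x\<in>#degree_sequence (del_vertex G v). 2 * x \<le> \<Sum>\<^sub># (degree_sequence (del_vertex G v))"
    unfolding sum_degree_sequence[OF G'] by (auto simp: degree_sequence_def vertex_degree_le_size)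
  ultimately show ?thesis
    unfolding deletion_step_def mx sum_degree_sequence[OF G] sum_degree_sequence[OF G']
    using size_edges_del_vertex[of G v] by auto
qed

section \<open>The lower bound and independence for every run\<close>

text \<open>While MAX shrinks the graph, \<open>D\<close> runs through the iterates of
  \<open>Omega\<close>. The disjunction is the invariant; its first part covers a run about to stop,
  where \<open>D\<close> itself may be nontrivial.\<close>

lemma MAX_result_lower_bound:
  assumes "MAX_result k G S" "k > 0" "loopless_multigraph G" "size D = card (verts G)"
    and "trivial_seq k (degree_sequence G) \<or> dominates k D (degree_sequence G)"
  shows "b_bound k D \<le> card S"
  using assms
proof (induction arbitrary: D rule: MAX_result.induct)
  case (stop H)
  then show ?case using b_bound_le_size[OF \<open>k > 0\<close>, of D] by simp
next
  case (delete H v S)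
  have H: "loopless_multigraph H" "size D = card (verts H)" by fact+
  have v: "v \<in> verts H" "vertex_degree H v = max_degree H" by fact+
  have H': "loopless_multigraph (del_vertex H v)" using MAX_terminates(1)[OF H(1) v(1)] .
  have nt: "\<not> trivial_seq k (degree_sequence H)"
    using max_degree_less_iff[OF H(1) \<open>k > 0\<close>] \<open>max_degree H \<ge> k\<close> by simp
  then have dom: "dominates k D (degree_sequence H)" using delete.prems(4) by blast
  \<comment> \<open>Domination of the heavy counts makes \<open>D\<close> nontrivial too, so
    \<open>Omega\<close> takes another step as well.\<close>
  then have ntD: "\<not> trivial_seq k D"
    using nt by (auto simp: trivial_seq_iff_heavy dominates_def)
  have "D \<noteq> {#}" using ntD by (auto simp: trivial_seq_def)
  have fin: "finite (verts H)" using H(1) by (simp add: loopless_multigraph_def)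
  have "size (Omega k D) = card (verts (del_vertex H v))"
    unfolding size_Omega[OF \<open>D \<noteq> {#}\<close> \<open>k > 0\<close>] using H(2) v(1) fin by (simp add: del_vertex_def)
  moreover have "trivial_seq k (degree_sequence (del_vertex H v)) \<or>
      dominates k (Omega k D) (degree_sequence (del_vertex H v))"
    using dominates_step[OF dom deletion_step_del_vertex[OF H(1) v] ntD] by blast
  ultimately have "b_bound k (Omega k D) \<le> card S" using delete.IH[OF \<open>k > 0\<close> H'] by simp
  then show ?case using b_bound_Omega[OF \<open>k > 0\<close> ntD] by simp
qed

text \<open>Deleting a vertex outside \<open>S\<close> does not alter the subgraph induced by
  \<open>S\<close>, so the stopping condition carries back to the original graph.\<close>

lemma MAX_result_k_independent:
  assumes "MAX_result k G S" "loopless_multigraph G"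
  shows "k_independent k G S"
  using assms
proof (induction rule: MAX_result.induct)
  case (stop H)
  have "induced_subgraph H (verts H) = \<lparr>verts = verts H, edges = edges H\<rparr>"
    using stop by (simp add: induced_subgraph_def loopless_multigraph_def cong: filter_mset_cong)
  then show ?case using stop by (simp add: k_independent_def max_degree_def vertex_degree_def)
next
  case (delete H v S)
  have ind: "k_independent k (del_vertex H v) S"
    using delete.IH MAX_terminates(1)[OF delete.prems \<open>v \<in> verts H\<close>] .
  then have S: "S \<subseteq> verts H - {v}" by (simp add: k_independent_def del_vertex_def)
  then have "induced_subgraph (del_vertex H v) S = induced_subgraph H S"
    by (auto simp: induced_subgraph_def del_vertex_def filter_filter_mset intro!: filter_mset_cong)
  then show ?case using ind S by (auto simp: k_independent_def)
qed

section \<open>Realising sequences by loopless multigraphs\<close>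

lemma obtains_max_point:
  fixes f :: "'a \<Rightarrow> nat"
  assumes "finite V" "V \<noteq> {}"
  obtains x where "x \<in> V" "\<And>z. z \<in> V \<Longrightarrow> f z \<le> f x"
proof -
  obtain x where x: "x \<in> V" "Max (f ` V) = f x" using obtains_MAX[OF assms] .
  have "f z \<le> f x" if "z \<in> V" for z
    unfolding x(2)[symmetric] using assms(1) that by (intro Max_ge) auto
  then show thesis using that x(1) by blast
qed

text \<open>Join the two vertices of largest demand by an edge and lower both demands by one; the
  conditions survive, so induction on the total demand applies.\<close>

lemma multigraph_with_degrees:
  fixes V :: "'a set"
  assumes "finite V" "even (sum f V)" "\<And>x. x \<in> V \<Longrightarrow> 2 * f x \<le> sum f V"
  shows "\<exists>G. loopless_multigraph G \<and> verts G = V \<and> (\<forall>x\<in>V. vertex_degree G x = f x)"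
  using assms
proof (induction "sum f V" arbitrary: f rule: less_induct)
  case less
  show ?case
  proof (cases "sum f V = 0")
    case True
    then have "\<forall>x\<in>V. f x = 0" using less by simp
    then show ?thesis using less
      by (intro exI[of _ "\<lparr>verts = V, edges = {#}\<rparr>"]) (simp add: loopless_multigraph_def vertex_degree_def)
  next
    case False
    then have "V \<noteq> {}" by auto
    then obtain x where x: "x \<in> V" "\<And>z. z \<in> V \<Longrightarrow> f z \<le> f x"
      using obtains_max_point[OF less.prems(1), of f] by blast
    have sx: "sum f V = f x + sum f (V - {x})" using less.prems(1) x(1) by (rule sum.remove)
    have "f x > 0"
    proof (rule ccontr)
      assume "\<not> f x > 0"
      then have "sum f V = 0" using x(2) by simp
      then show False using False by simp
    qed
    \<comment> \<open>The largest demand is at most half of the total, so the other vertices share a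
      positive demand.\<close>
    then have ne: "V - {x} \<noteq> {}" using sx less.prems(3)[OF x(1)] by force
    then obtain y where y: "y \<in> V - {x}" "\<And>z. z \<in> V - {x} \<Longrightarrow> f z \<le> f y"
      using obtains_max_point[OF finite_Diff[OF less.prems(1)] ne, of f] by blast
    have "f y > 0"
    proof (rule ccontr)
      assume "\<not> f y > 0"
      then have "sum f (V - {x}) = 0" using y(2) by simp
      then show False using sx less.prems(3)[OF x(1)] \<open>f x > 0\<close> by simp
    qed
    have sy: "sum f (V - {x}) = f y + sum f (V - {x} - {y})"
      using less.prems(1) y(1) by (intro sum.remove) auto
    define g where "g = f(x := f x - 1, y := f y - 1)"
    have yx: "y \<in> V" "y \<noteq> x" using y by auto
    have "sum g V = g x + (g y + sum g (V - {x} - {y}))"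
      using less.prems(1) x(1) y(1) by (simp add: sum.remove[of V x] sum.remove[of "V - {x}" y])
    also have "sum g (V - {x} - {y}) = sum f (V - {x} - {y})"
      by (intro sum.cong) (auto simp: g_def)
    finally have sg: "sum g V + 2 = sum f V"
      using sx sy \<open>f x > 0\<close> \<open>f y > 0\<close> yx by (simp add: g_def)
    have "2 * g z \<le> sum g V" if z: "z \<in> V" for z
    proof (cases "z = x \<or> z = y")
      case True
      then show ?thesis
        using sg less.prems(3)[OF x(1)] less.prems(3)[OF yx(1)] \<open>f x > 0\<close> \<open>f y > 0\<close> yx
        by (auto simp: g_def)
    next
      case F: False
      then have "f z \<le> f y" using z y by auto
      have "sum f (V - {x} - {y}) = f z + sum f (V - {x} - {y} - {z})"
        using less.prems(1) z F by (intro sum.remove) auto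
      \<comment> \<open>With total \<open>2 * s\<close>, a third value \<open>f z \<ge> s\<close>
        would force \<open>f x\<close> and \<open>f y\<close> to be at least \<open>s\<close> as
        well, exceeding the total.\<close>
      then have "f x + f y + f z \<le> sum f V" using sx sy by simp
      moreover obtain s where "sum f V = 2 * s" using less.prems(2) by (rule evenE)
      ultimately have "f z < s" "sum f V = 2 * s"
        using \<open>f z \<le> f y\<close> x(2)[OF yx(1)] \<open>f y > 0\<close> by linarith+
      then show ?thesis using F sg by (simp add: g_def)
    qed
    moreover have "even (sum g V)" using sg less.prems(2) by (metis dvd_add_left_iff dvd_refl)
    ultimately obtain G where G: "loopless_multigraph G" "verts G = V"
      "\<forall>x\<in>V. vertex_degree G x = g x"
      using less.hyps[of g] less.prems(1) sg by auto
    define G' where "G' = \<lparr>verts = V, edges = add_mset {x, y} (edges G)\<rparr>"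
    have "loopless_multigraph G'"
      using G x(1) yx by (auto simp: G'_def loopless_multigraph_def)
    moreover have "vertex_degree G' z = f z" if "z \<in> V" for z
    proof -
      have "vertex_degree G' z = (if z = x \<or> z = y then 1 else 0) + vertex_degree G z"
        by (simp add: G'_def vertex_degree_def)
      then show ?thesis using G(3) that \<open>f x > 0\<close> \<open>f y > 0\<close> yx by (auto simp: g_def)
    qed
    ultimately show ?thesis by (intro exI[of _ G']) (simp add: G'_def)
  qed
qed

text \<open>Positions in a list serve as vertices, so that repeated elements of \<open>D\<close> get
  distinct vertices.\<close>

lemma is_degree_sequenceI:
  assumes "even (\<Sum>\<^sub># D)" "\<And>x. x \<in># D \<Longrightarrow> 2 * x \<le> \<Sum>\<^sub># D"
  shows "is_degree_sequence D"
proof -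
  obtain xs where xs: "mset xs = D" using ex_mset by blast
  define V where "V = {..<length xs}"
  have im: "image_mset ((!) xs) (mset_set V) = D"
    unfolding V_def xs[symmetric] lessThan_atLeast0 by (metis map_nth mset_map mset_upt)
  then have s: "(\<Sum>i\<in>V. xs ! i) = \<Sum>\<^sub># D" by (metis sum_unfold_sum_mset)
  have "xs ! i \<in># D" if "i \<in> V" for i using that xs by (auto simp: V_def)
  then obtain G where G: "loopless_multigraph G" "verts G = V" "\<forall>x\<in>V. vertex_degree G x = xs ! x"
    using multigraph_with_degrees[of V "(!) xs"] assms s V_def by auto
  have "degree_sequence G = D"
    unfolding im[symmetric] degree_sequence_def G(2)
    by (rule image_mset_cong) (use G(3) V_def in auto)
  then show ?thesis unfolding is_degree_sequence_def using G(1) by blast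
qed

text \<open>Decrements are undone one at a time, each raising the label of one vertex. For the
  degrees of a realisation of \<open>Omega k D\<close>, the surplus of \<open>g\<close> tells how
  many edges the new vertex sends to each old one.\<close>

lemma lift_degrees_funpow_next_multiset:
  assumes "finite V" "i \<le> \<Sum>\<^sub># A" "image_mset f (mset_set V) = (next_multiset k ^^ i) A"
  shows "\<exists>g. (\<forall>w\<in>V. f w \<le> g w) \<and> image_mset g (mset_set V) = A"
  using assms(2,3)
proof (induction i arbitrary: f)
  case 0
  then show ?case by auto
next
  case (Suc i)
  let ?B = "(next_multiset k ^^ i) A"
  have "\<Sum>\<^sub># ?B > 0" using sum_mset_funpow_next_multiset[of i A k] Suc.prems by simp
  then obtain a C where B: "?B = add_mset a C" "a > 0" "next_multiset k ?B = add_mset (a - 1) C"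
    using next_multiset_cases by metis
  have im: "image_mset f (mset_set V) = add_mset (a - 1) C" using Suc.prems B by simp
  then have "a - 1 \<in># image_mset f (mset_set V)" by simp
  \<comment> \<open>Any vertex labelled \<open>a - 1\<close> may play the part of the decremented
    element.\<close>
  then obtain w where w: "w \<in> V" "f w = a - 1" using assms(1) by auto
  have rem: "mset_set V = add_mset w (mset_set (V - {w}))"
    using assms(1) w(1) by (rule mset_set.remove)
  have "image_mset (f(w := a)) (mset_set (V - {w})) = image_mset f (mset_set (V - {w}))"
    using assms(1) by (intro image_mset_cong) auto
  then have "image_mset (f(w := a)) (mset_set V) = ?B"
    using im rem w(2) B(1) by simp
  then obtain g where g: "\<forall>u\<in>V. (f(w := a)) u \<le> g u" "image_mset g (mset_set V) = A"
    using Suc.IH Suc.prems by (metis Suc_leD)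
  have "f u \<le> g u" if "u \<in> V" for u
    using g(1) that w(2) by (cases "u = w") (force, fastforce)
  then show ?case using g(2) by blast
qed

lemma size_sum_mset_family:
  fixes F :: "'a \<Rightarrow> 'b multiset"
  shows "finite V \<Longrightarrow> size (\<Sum>w\<in>V. F w) = (\<Sum>w\<in>V. size (F w))"
  by (induction V rule: finite_induct) auto

lemma filter_sum_mset_family:
  fixes F :: "'a \<Rightarrow> 'b multiset"
  shows "finite V \<Longrightarrow> filter_mset P (\<Sum>w\<in>V. F w) = (\<Sum>w\<in>V. filter_mset P (F w))"
  by (induction V rule: finite_induct) auto

text \<open>Each \<open>w\<close> is joined to \<open>v\<close> by
  \<open>g w - vertex_degree G w\<close> parallel edges; the hypothesis on \<open>g\<close> makes
  this subtraction exact.\<close>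

lemma add_vertex:
  assumes G: "loopless_multigraph G" and v: "v \<notin> verts G"
    and g: "\<forall>w\<in>verts G. vertex_degree G w \<le> g w"
  obtains G' where "loopless_multigraph G'" "del_vertex G' v = G" "verts G' = insert v (verts G)"
    "\<And>w. w \<in> verts G \<Longrightarrow> vertex_degree G' w = g w"
    "vertex_degree G' v = (\<Sum>w\<in>verts G. g w - vertex_degree G w)"
proof -
  let ?V = "verts G"
  have fin: "finite ?V" using G by (simp add: loopless_multigraph_def)
  define F where "F = (\<Sum>w\<in>?V. replicate_mset (g w - vertex_degree G w) {v, w})"
  define G' where "G' = \<lparr>verts = insert v ?V, edges = edges G + F\<rparr>"
  have F: "\<exists>w\<in>?V. e = {v, w}" if "e \<in># F" for e
    using that fin by (auto simp: F_def set_mset_sum split: if_splits)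
  have eG: "v \<notin> e" if "e \<in># edges G" for e
    using that G v by (auto simp: loopless_multigraph_def)
  have "e \<subseteq> insert v ?V \<and> card e = 2" if e: "e \<in># edges G + F" for e
  proof (cases "e \<in># F")
    case True
    then obtain w where "w \<in> ?V" "e = {v, w}" using F by blast
    then show ?thesis using v by (auto simp: card_insert_if)
  next
    case False
    then show ?thesis using e G by (auto simp: loopless_multigraph_def)
  qed
  then have ll: "loopless_multigraph G'"
    using fin by (simp add: loopless_multigraph_def G'_def)
  have "{#e \<in># edges G. v \<notin> e#} = edges G" using eG by (auto simp: filter_mset_eq_conv)
  moreover have "{#e \<in># F. v \<notin> e#} = {#}" using F by (auto simp: filter_mset_eq_conv)
  ultimately have del: "del_vertex G' v = G" using v by (simp add: del_vertex_def G'_def)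
  have rep: "{#e \<in># replicate_mset n x. P e#} = (if P x then replicate_mset n x else {#})"
    for n and x :: "'a set" and P
    by (induction n) auto
  have degw: "vertex_degree G' w = g w" if w: "w \<in> ?V" for w
  proof -
    have "size {#e \<in># F. w \<in> e#} = (\<Sum>u\<in>?V. if u = w then g w - vertex_degree G w else 0)"
      unfolding F_def filter_sum_mset_family[OF fin] size_sum_mset_family[OF fin]
      using w v by (intro sum.cong) (auto simp: rep)
    then show ?thesis using fin w g by (simp add: G'_def vertex_degree_def)
  qed
  have "{#e \<in># edges G. v \<in> e#} = {#}" using eG by (auto simp: filter_mset_eq_conv)
  moreover have "{#e \<in># F. v \<in> e#} = F" using F by (auto simp: filter_mset_eq_conv)
  ultimately have "vertex_degree G' v = (\<Sum>w\<in>?V. g w - vertex_degree G w)"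
    by (simp add: G'_def vertex_degree_def F_def size_sum_mset_family[OF fin])
  then show thesis using that[OF ll del _ degw] by (simp add: G'_def)
qed

section \<open>Sharpness and conclusion\<close>

text \<open>Extremal graphs are built backwards along \<open>Omega\<close>: one for
  \<open>Omega k D\<close> receives a vertex of maximum degree that MAX may delete first.\<close>

lemma MAX_result_bound_attained:
  assumes "k > 0" "is_degree_sequence D"
  shows "\<exists>(G :: nat multigraph) S.
    loopless_multigraph G \<and> degree_sequence G = D \<and> MAX_result k G S \<and> card S = b_bound k D"
  using assms(2)
proof (induction "size D" arbitrary: D rule: less_induct)
  case less
  obtain G0 :: "nat multigraph" where G0: "loopless_multigraph G0" "degree_sequence G0 = D"
    using less.prems unfolding is_degree_sequence_def by blast
  show ?case
  proof (cases "trivial_seq k D")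
    case True
    then have "MAX_result k G0 (verts G0)"
      using max_degree_less_iff[OF G0(1) assms(1)] G0(2) MAX_result.stop by blast
    moreover have "card (verts G0) = b_bound k D"
      using b_bound_trivial[OF True] size_degree_sequence G0(2) by metis
    ultimately show ?thesis using G0 by blast
  next
    case False
    then have Dne: "D \<noteq> {#}" by (auto simp: trivial_seq_def)
    define d where "d = Max_mset D"
    have "d \<in># D" unfolding d_def using Dne by (intro Max_in) auto
    then obtain A where A: "D = add_mset d A" by (meson multi_member_split)
    have ev: "even (\<Sum>\<^sub># D)" using sum_degree_sequence[OF G0(1)] G0(2) by simp
    have sumA: "\<Sum>\<^sub># D = d + \<Sum>\<^sub># A" by (subst A) simp
    have szO: "size (Omega k D) = size D - 1" using size_Omega[OF Dne assms(1)] .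
    have bO: "b_bound k D = b_bound k (Omega k D)" using b_bound_Omega[OF assms(1) False] .
    show ?thesis
    \<comment> \<open>The condition singles out the last case in the definition of
      \<open>Omega\<close>.\<close>
    proof (cases "2 * d + 2 * k \<le> \<Sum>\<^sub># D \<and> heavy k A > 0")
      case True
      note Om = Omega_nontrivial[OF A[unfolded d_def] ev _ True[THEN conjunct1, unfolded d_def],
          OF True[THEN conjunct2], folded d_def]
      define B where "B = Omega k D"
      note Om' = Om(2-5)[folded Om(1), folded B_def]
      have evB: "even (\<Sum>\<^sub># B)" using Om'(1) ev by (metis dvd_triv_left even_add)
      \<comment> \<open>If all elements are at most \<open>k\<close>, the sum is still at least
        \<open>2 * k\<close>; otherwise the near-tie at the top and parity bound the maximum by half
        of the sum.\<close>
      have "2 * x \<le> \<Sum>\<^sub># B" if x: "x \<in># B" for x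
        using Om'(4)
      proof
        assume "\<forall>x\<in>#B. x \<le> k"
        then have "x \<le> k" using x by blast
        then show ?thesis using Om'(1) True by linarith
      next
        assume "\<exists>x y C. B = add_mset x (add_mset y C) \<and> x = Max_mset B \<and> x \<le> Suc y"
        then obtain y C where yC: "B = add_mset (Max_mset B) (add_mset y C)" "Max_mset B \<le> Suc y"
          by metis
        have "\<Sum>\<^sub># B = Max_mset B + y + \<Sum>\<^sub># C" by (subst yC(1)) simp
        then have "2 * Max_mset B \<le> Suc (\<Sum>\<^sub># B)" using yC(2) by simp
        then have "2 * Max_mset B \<le> \<Sum>\<^sub># B" using evB by presburger
        then show ?thesis using x by (meson Max_ge finite_set_mset le_trans mult_le_mono2)
      qed
      then have "is_degree_sequence B" using is_degree_sequenceI evB by blast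
      moreover have "size B < size D" using szO Dne by (simp add: B_def nonempty_has_size)
      ultimately obtain H :: "nat multigraph" and S where H: "loopless_multigraph H"
        "degree_sequence H = B" "MAX_result k H S" "card S = b_bound k B"
        using less.hyps by blast
      have fin: "finite (verts H)" using H(1) by (simp add: loopless_multigraph_def)
      have le: "d \<le> \<Sum>\<^sub># A" using True sumA by simp
      obtain g where g: "\<forall>w\<in>verts H. vertex_degree H w \<le> g w" "image_mset g (mset_set (verts H)) = A"
        using lift_degrees_funpow_next_multiset[OF fin le, of "vertex_degree H" k]
          H(2) Om(1) by (auto simp: B_def degree_sequence_def)
      obtain v where v: "v \<notin> verts H" using fin ex_new_if_finite infinite_UNIV_nat by blast
      obtain G where G: "loopless_multigraph G" "del_vertex G v = H" "verts G = insert v (verts H)"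
        "\<And>w. w \<in> verts H \<Longrightarrow> vertex_degree G w = g w"
        "vertex_degree G v = (\<Sum>w\<in>verts H. g w - vertex_degree H w)"
        using add_vertex[OF H(1) v g(1)] by blast
      have "(\<Sum>w\<in>verts H. g w - vertex_degree H w) = sum g (verts H) - sum (vertex_degree H) (verts H)"
        using g(1) by (intro sum_subtractf_nat) auto
      also have "\<dots> = \<Sum>\<^sub># A - \<Sum>\<^sub># B"
        using g(2) H(2) by (simp add: sum_unfold_sum_mset degree_sequence_def)
      also have "\<dots> = d" using Om'(1) sumA by simp
      finally have dv: "vertex_degree G v = d" using G(5) by simp
      have "image_mset (vertex_degree G) (mset_set (verts H)) = A"
        unfolding g(2)[symmetric] by (intro image_mset_cong) (use fin G(4) in auto)
      then have dG: "degree_sequence G = D"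
        using v fin dv A by (simp add: degree_sequence_def G(3))
      have mx: "max_degree G = d"
        using max_degree_eq_Max_mset[of G] G(3) fin dG d_def by simp
      have "d \<ge> k" using False unfolding trivial_seq_def d_def by simp
      \<comment> \<open>The new vertex has the maximum degree \<open>d\<close>, so MAX may delete it
        first and continue on \<open>H\<close>.\<close>
      then have "MAX_result k G S"
        using G dv mx H(3) by (intro MAX_result.delete[of k G v]) auto
      then show ?thesis using G(1) dG H(4) bO B_def by metis
    next
      \<comment> \<open>Any realisation serves here: deleting one vertex of maximum degree already
        ends the run, and \<open>Omega\<close> gives only zeros.\<close>
      case deg: False
      have md: "max_degree G0 \<ge> k"
        using False max_degree_less_iff[OF G0(1) assms(1)] G0(2) by simp
      then obtain v where v: "v \<in> verts G0" "vertex_degree G0 v = max_degree G0"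
        using MAX_progress[OF G0(1) assms(1)] by blast
      define D' where "D' = degree_sequence (del_vertex G0 v)"
      have fin: "finite (verts G0)" using G0(1) by (simp add: loopless_multigraph_def)
      have st: "deletion_step D D'"
        using deletion_step_del_vertex[OF G0(1) v] G0(2) D'_def by simp
      have tr: "trivial_seq k D'"
      proof (cases "heavy k A = 0")
        case True
        obtain A' where "D = add_mset d A'" "heavy k D' \<le> heavy k A'"
          using st unfolding deletion_step_def d_def by blast
        then show ?thesis using A True by (simp add: trivial_seq_iff_heavy)
      next
        case False
        \<comment> \<open>Less than \<open>2 * k\<close> remains of the sum, and no degree exceeds
          half of it.\<close>
        then have "\<Sum>\<^sub># D' < 2 * k" using deg st unfolding deletion_step_def d_def by auto
        then show ?thesis using st unfolding deletion_step_def trivial_seq_iff by fastforce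
      qed
      have "loopless_multigraph (del_vertex G0 v)" using MAX_terminates[OF G0(1) v(1)] by blast
      then have "MAX_result k (del_vertex G0 v) (verts (del_vertex G0 v))"
        using max_degree_less_iff[OF _ assms(1)] tr D'_def MAX_result.stop by blast
      then have res: "MAX_result k G0 (verts (del_vertex G0 v))"
        using MAX_result.delete[OF md v] by blast
      have "D - {#Max_mset D#} = A" using A d_def by (metis add_mset_remove_trivial)
      moreover have "\<Sum>\<^sub># A < d + 2 * k \<or> Max_mset A < k"
      \<comment> \<open>An empty \<open>A\<close> is settled by its sum, since
        \<open>Max_mset {#}\<close> is unspecified.\<close>
      proof (cases "A = {#} \<or> heavy k A > 0")
        case True
        then show ?thesis using deg assms(1) sumA by auto
      next
        case False
        then show ?thesis by (simp add: heavy_eq_0_iff)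
      qed
      ultimately have "Omega k D = replicate_mset (size D - 1) 0"
        unfolding Omega_def Let_def by (simp flip: d_def)
      then have "trivial_seq k (Omega k D)" using assms(1) by (auto simp: trivial_seq_iff)
      then have "b_bound k D = size D - 1" using bO b_bound_trivial szO by simp
      also have "\<dots> = card (verts (del_vertex G0 v))"
        using G0(2) size_degree_sequence[of G0] v fin by (simp add: del_vertex_def)
      finally show ?thesis using G0 res by metis
    qed
  qed
qed

theorem theorem1p1:
  fixes k :: nat and D :: "nat multiset"
  assumes "k > 0" and "is_degree_sequence D"
  shows "(\<forall>(G :: 'a multigraph) S.
            loopless_multigraph G \<and> degree_sequence G = D \<and> MAX_result k G S \<longrightarrow>
              k_independent k G S \<and> card S \<ge> b_bound k D) \<and>
         (\<exists>(G :: nat multigraph) S.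
            loopless_multigraph G \<and> degree_sequence G = D \<and> MAX_result k G S \<and>
              k_independent k G S \<and> card S = b_bound k D)"
proof (intro conjI allI impI)
  fix G :: "'a multigraph" and S
  assume G: "loopless_multigraph G \<and> degree_sequence G = D \<and> MAX_result k G S"
  then show "k_independent k G S" using MAX_result_k_independent by blast
  have "even (\<Sum>\<^sub># D)" using G sum_degree_sequence by fastforce
  \<comment> \<open>The invariant holds at the start because domination is reflexive on sequences of
    even sum.\<close>
  then have "dominates k D (degree_sequence G)" using G by (simp add: dominates_def)
  then show "b_bound k D \<le> card S"
    using MAX_result_lower_bound[of k G S D] G assms(1) size_degree_sequence by metis
next
  show "\<exists>(G :: nat multigraph) S.
            loopless_multigraph G \<and> degree_sequence G = D \<and> MAX_result k G S \<and>
              k_independent k G S \<and> card S = b_bound k D"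
    using MAX_result_bound_attained[OF assms] MAX_result_k_independent by blast
qed

end
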